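(* Every graph that is bipartite and whose complement is a circle graph is a Stick graph.
   Context: A circle graph is the intersection graph of a family of chords of a circle. A Stick graph is the intersection graph of a set of vertical segments and a set of horizontal segments in the plane whose bottom endpoints (vertical ones) and left endpoints (horizontal ones) lie on a fixed line of slope $-1$. *)

theory Defs
  imports "HOL-Analysis.Analysis" "Graph_Theory.Pair_Digraph"
begin

text \<open>
  A finite simple graph is a \<open>pair_graph\<close>: finite vertex set, arc relation symmetric and loop-free.
  The Euclidean plane is \<open>real \<times> real\<close>, whose product metric is the Euclidean one.
\<close>

definition bipartite :: "'a pair_pre_digraph \<Rightarrow> bool" where
  "bipartite G \<longleftrightarrow> (\<exists>A B. A \<union> B = pverts G \<and> A \<inter> B = {} \<and>
     parcs G \<subseteq> A \<times> B \<union> B \<times> A)"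

definition graph_complement :: "'a pair_pre_digraph \<Rightarrow> 'a pair_pre_digraph" where
  "graph_complement G =
     \<lparr> pverts = pverts G,
       parcs = {(u, v). u \<in> pverts G \<and> v \<in> pverts G \<and> u \<noteq> v \<and> (u, v) \<notin> parcs G} \<rparr>"

lemma pair_graph_graph_complement:
  assumes "pair_graph G"
  shows "pair_graph (graph_complement G)"
proof -
  interpret pair_graph G by fact
  have "finite (pverts G \<times> pverts G)"
    using pair_finite_verts by simp
  then have "finite (parcs (graph_complement G))"
    by (rule rev_finite_subset) (auto simp: graph_complement_def)
  moreover have "symmetric (graph_complement G)"
    using pair_sym_arcs
    by (auto simp: symmetric_def graph_complement_def sym_def)
  ultimately show ?thesis
    using pair_finite_verts
    by unfold_locales (auto simp: graph_complement_def)
qed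

text \<open>
  The family is indexed by the vertices, so no separate isomorphism is needed.
\<close>

definition is_intersection_graph :: "'a pair_pre_digraph \<Rightarrow> ('a \<Rightarrow> 'b set) \<Rightarrow> bool" where
  "is_intersection_graph G S \<longleftrightarrow>
     (\<forall>u\<in>pverts G. \<forall>v\<in>pverts G. u \<noteq> v \<longrightarrow>
        ((u, v) \<in> parcs G \<longleftrightarrow> S u \<inter> S v \<noteq> {}))"

definition is_chord :: "real \<times> real \<Rightarrow> real \<Rightarrow> (real \<times> real) set \<Rightarrow> bool" where
  "is_chord c r S \<longleftrightarrow>
     (\<exists>a\<in>sphere c r. \<exists>b\<in>sphere c r. a \<noteq> b \<and> S = closed_segment a b)"

text \<open>
  Chords of the family may coincide or share endpoints on the circle; a shared endpoint counts
  as an intersection.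
\<close>

definition circle_graph :: "'a pair_pre_digraph \<Rightarrow> bool" where
  "circle_graph G \<longleftrightarrow>
     (\<exists>c r S. r > 0 \<and> (\<forall>v\<in>pverts G. is_chord c r (S v)) \<and> is_intersection_graph G S)"

text \<open>
  The ground line of slope \<open>-1\<close> with offset \<open>d\<close> is \<open>{(x, y). x + y = d}\<close>.
\<close>

definition vertical_stick :: "real \<Rightarrow> (real \<times> real) set \<Rightarrow> bool" where
  "vertical_stick d S \<longleftrightarrow>
     (\<exists>x y l. x + y = d \<and> l > 0 \<and> S = closed_segment (x, y) (x, y + l))"

definition horizontal_stick :: "real \<Rightarrow> (real \<times> real) set \<Rightarrow> bool" where
  "horizontal_stick d S \<longleftrightarrow>
     (\<exists>x y l. x + y = d \<and> l > 0 \<and> S = closed_segment (x, y) (x + l, y))"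

text \<open>
  Injectivity says that the segments form a set: distinct vertices get distinct segments.
  Adjacency is intersection for all pairs, including two parallel segments.
\<close>

definition stick_graph :: "'a pair_pre_digraph \<Rightarrow> bool" where
  "stick_graph G \<longleftrightarrow>
     (\<exists>d S. inj_on S (pverts G) \<and>
        (\<forall>v\<in>pverts G. vertical_stick d (S v) \<or> horizontal_stick d (S v)) \<and>
        is_intersection_graph G S)"

end

theory Submission
  imports Defs
begin

text \<open>
  Cut the circle at a point, so that a chord of the complement becomes an interval \<open>[l, r]\<close> and two
  chords are disjoint iff the intervals are disjoint or strictly nested. The two sides \<open>A\<close> and \<open>B\<close>
  of the bipartite graph are families of pairwise meeting chords. Therefore all chords disjoint
  from a given one lie on the same side of it, and it can be replaced by the arc \<open>[s, t]\<close> on the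
  other side; then \<open>a\<close> and \<open>b\<close> are adjacent iff their arcs are disjoint. For a suitable cut, no
  \<open>a \<in> A\<close> lies to the left of an adjacent \<open>b \<in> B\<close>. Order the vertices along the ground line by the
  start of the arc for \<open>a \<in> A\<close> and by the end of the arc for \<open>b \<in> B\<close>. Every edge then has \<open>b\<close>
  before \<open>a\<close>. If \<open>b' < b < a < a'\<close> with edges \<open>ab'\<close> and \<open>a'b\<close> but no edge \<open>ab\<close>, the arc of \<open>a'\<close>
  would lie strictly inside that of \<open>a\<close>, although the two chords meet. So it is safe to extend each
  stick exactly to its last neighbour.
\<close>

section \<open>Separated intervals, and segments in the plane\<close>

text \<open>All inequalities are strict because chords with a common endpoint meet.\<close>

definition separated :: "real \<Rightarrow> real \<Rightarrow> real \<Rightarrow> real \<Rightarrow> bool" where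
  "separated l r l' r' \<longleftrightarrow> r < l' \<or> r' < l \<or> l < l' \<and> r' < r \<or> l' < l \<and> r < r'"

text \<open>The determinant of two plane vectors: the sign of \<open>cross2 (q - p) (z - p)\<close>
  tells on which side of the line through \<open>p\<close> and \<open>q\<close> the point
  \<open>z\<close> lies.\<close>

definition cross2 :: "real \<times> real \<Rightarrow> real \<times> real \<Rightarrow> real" where
  "cross2 p q = fst p * snd q - snd p * fst q"

lemma closed_segments_meet:
  assumes F: "cross2 (q - p) (a - p) * cross2 (q - p) (b - p) < 0"
    and G: "cross2 (b - a) (p - a) * cross2 (b - a) (q - a) < 0"
  shows "closed_segment p q \<inter> closed_segment a b \<noteq> {}"
proof -
  define Fa Fb Gp Gq where "Fa = cross2 (q - p) (a - p)" and "Fb = cross2 (q - p) (b - p)"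
    and "Gp = cross2 (b - a) (p - a)" and "Gq = cross2 (b - a) (q - a)"
  \<comment> \<open>\<open>cross2 (q - p) (z - p)\<close> is affine in \<open>z\<close>, with values
    \<open>Fa\<close> at \<open>a\<close> and \<open>Fb\<close> at \<open>b\<close>, so it vanishes
    at the fraction \<open>m\<close> of the way from \<open>a\<close> to \<open>b\<close>; likewise
    \<open>k\<close> on the way from \<open>p\<close> to \<open>q\<close>. By \<open>D\<close> the
    denominators agree up to sign, and the two points turn out equal.\<close>
  define m where "m = Fa / (Fa - Fb)"
  define k where "k = Gp / (Gp - Gq)"
  have D: "Gp - Gq = Fb - Fa"
    by (simp add: Fa_def Fb_def Gp_def Gq_def cross2_def algebra_simps)
  have sF: "Fa * Fb < 0" and sG: "Gp * Gq < 0"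
    using F G by (simp_all add: Fa_def Fb_def Gp_def Gq_def)
  have unit: "0 \<le> x / (x - y) \<and> x / (x - y) \<le> 1" if "x * y < 0" for x y :: real
    using that by (auto simp: mult_less_0_iff divide_simps)
  have nz: "Fa - Fb \<noteq> 0" "Gp - Gq \<noteq> 0"
    using sF D by (auto simp: mult_less_0_iff)
  have "m * (fst b - fst a) + k * (fst p - fst q) = fst p - fst a"
       "m * (snd b - snd a) + k * (snd p - snd q) = snd p - snd a"
  proof -
    have k: "k = - Gp / (Fa - Fb)"
      using nz D unfolding k_def by (simp add: divide_simps) (simp add: algebra_simps)
    have "Fa * (fst b - fst a) - Gp * (fst p - fst q) = (fst p - fst a) * (Fa - Fb)"
         "Fa * (snd b - snd a) - Gp * (snd p - snd q) = (snd p - snd a) * (Fa - Fb)"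
      by (simp_all add: Fa_def Fb_def Gp_def cross2_def algebra_simps)
    then show "m * (fst b - fst a) + k * (fst p - fst q) = fst p - fst a"
       "m * (snd b - snd a) + k * (snd p - snd q) = snd p - snd a"
      using nz(1) unfolding m_def k by (simp_all add: divide_simps)
  qed
  then have eq: "(1 - k) *\<^sub>R p + k *\<^sub>R q = (1 - m) *\<^sub>R a + m *\<^sub>R b"
    by (intro prod_eqI) (simp_all add: algebra_simps)
  have "0 \<le> k" "k \<le> 1" "0 \<le> m" "m \<le> 1"
    using unit[OF sF] unit[OF sG] unfolding m_def k_def by auto
  then have "(1 - k) *\<^sub>R p + k *\<^sub>R q \<in> closed_segment p q"
    "(1 - k) *\<^sub>R p + k *\<^sub>R q \<in> closed_segment a b"
    unfolding in_segment using eq by blast+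
  then show ?thesis by blast
qed

text \<open>\<open>a\<close> and \<open>b\<close> lie strictly on one side of the line through
  \<open>p\<close> and \<open>q\<close>, hence so does every convex combination of them.\<close>

lemma closed_segments_disjoint:
  assumes "cross2 (q - p) (a - p) * cross2 (q - p) (b - p) > 0"
  shows "closed_segment p q \<inter> closed_segment a b = {}"
proof (rule ccontr)
  define F where "F z = cross2 (q - p) (z - p)" for z
  assume meet: "\<not> ?thesis"
  obtain k m where m: "0 \<le> m" "m \<le> 1"
    and eq: "(1 - k) *\<^sub>R p + k *\<^sub>R q = (1 - m) *\<^sub>R a + m *\<^sub>R b"
    proof -
    obtain z where "z \<in> closed_segment p q" "z \<in> closed_segment a b"
      using meet by blast
    then show thesis using that unfolding in_segment by metis
  qed
  have "F ((1 - k) *\<^sub>R p + k *\<^sub>R q) = 0"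
    by (simp add: F_def cross2_def algebra_simps)
  moreover have "F ((1 - m) *\<^sub>R a + m *\<^sub>R b) = (1 - m) * F a + m * F b"
    by (simp add: F_def cross2_def algebra_simps)
  ultimately have zero: "(1 - m) * F a + m * F b = 0"
    using eq by simp
  have pos: "(1 - m) * x + m * y > 0" if "x > 0" "y > 0" for x y
  proof (cases "m = 0")
    case False
    then show ?thesis
      using m that by (intro add_nonneg_pos mult_nonneg_nonneg mult_pos_pos) auto
  qed (use that in simp)
  have "F a * F b > 0" using assms by (simp add: F_def)
  then have "F a > 0 \<and> F b > 0 \<or> - F a > 0 \<and> - F b > 0"
    by (auto simp: zero_less_mult_iff)
  then show False
    using pos[of "F a" "F b"] pos[of "- F a" "- F b"] zero by auto
qed

section \<open>Chords of a circle as intervals of angles\<close>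

definition circle_point :: "real \<times> real \<Rightarrow> real \<Rightarrow> real \<Rightarrow> real \<times> real" where
  "circle_point c \<rho> \<theta> = c + \<rho> *\<^sub>R (cos \<theta>, sin \<theta>)"

lemma circle_point_exists:
  assumes "p \<in> sphere c \<rho>" "\<rho> > 0"
  obtains \<theta> where "0 \<le> \<theta>" "\<theta> < 2 * pi" "p = circle_point c \<rho> \<theta>"
proof -
  define x y where "x = (fst p - fst c) / \<rho>" and "y = (snd p - snd c) / \<rho>"
  have "dist c p = \<rho>" using assms(1) by simp
  then have "(fst c - fst p)\<^sup>2 + (snd c - snd p)\<^sup>2 = \<rho>\<^sup>2"
    by (auto simp: dist_prod_def dist_real_def)
  then have "x\<^sup>2 + y\<^sup>2 = 1"
    using assms(2) unfolding x_def y_def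
    by (simp add: power_divide add_divide_distrib[symmetric] power2_commute)
  then obtain \<theta> where "0 \<le> \<theta>" "\<theta> < 2 * pi" "x = cos \<theta>" "y = sin \<theta>"
    using sincos_total_2pi by metis
  moreover have "p = circle_point c \<rho> \<theta>"
    using calculation assms(2) unfolding circle_point_def x_def y_def
    by (intro prod_eqI) (simp_all add: field_simps)
  ultimately show ?thesis using that by blast
qed

text \<open>Sum-to-product formulas turn the determinant into a product of sines of half
  differences, whose sign is easy to read off.\<close>

lemma cross2_circle_points:
  "cross2 (circle_point c \<rho> t - circle_point c \<rho> s) (circle_point c \<rho> x - circle_point c \<rho> s)
     = 4 * \<rho>\<^sup>2 * sin ((t - s) / 2) * sin ((x - s) / 2) * sin ((x - t) / 2)"
proof -
  have c: "cos u - cos v = - 2 * sin ((u + v) / 2) * sin ((u - v) / 2)" for u v :: real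
  proof -
    have "sin ((v - u) / 2) = - sin ((u - v) / 2)"
      by (metis minus_diff_eq minus_divide_left sin_minus)
    then show ?thesis by (simp add: cos_diff_cos)
  qed
  have s: "sin u - sin v = 2 * sin ((u - v) / 2) * cos ((u + v) / 2)" for u v :: real
    by (simp add: sin_diff_sin)
  have d: "sin ((x - t) / 2) = sin ((x + s) / 2) * cos ((t + s) / 2) - cos ((x + s) / 2) * sin ((t + s) / 2)"
  proof -
    have "(x - t) / 2 = (x + s) / 2 - (t + s) / 2" by (simp add: field_simps)
    then show ?thesis by (simp only: sin_diff)
  qed
  have "cross2 (circle_point c \<rho> t - circle_point c \<rho> s) (circle_point c \<rho> x - circle_point c \<rho> s)
    = \<rho>\<^sup>2 * ((cos t - cos s) * (sin x - sin s) - (sin t - sin s) * (cos x - cos s))"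
    by (simp add: cross2_def circle_point_def power2_eq_square algebra_simps)
  also have "\<dots> = 4 * \<rho>\<^sup>2 * sin ((t - s) / 2) * sin ((x - s) / 2) * sin ((x - t) / 2)"
    unfolding c s d by (simp add: algebra_simps)
  finally show ?thesis .
qed

text \<open>Half differences of angles in \<open>[0, 2 * pi)\<close> lie strictly between
  \<open>- pi\<close> and \<open>pi\<close>, where the sine has the sign of its argument.\<close>

lemma cross2_circle_points_sign:
  fixes c :: "real \<times> real"
  assumes "\<rho> > 0" "0 \<le> s" "s < t" "t < 2 * pi" "0 \<le> x" "x < 2 * pi"
  defines "F \<equiv> cross2 (circle_point c \<rho> t - circle_point c \<rho> s) (circle_point c \<rho> x - circle_point c \<rho> s)"
  shows "s < x \<Longrightarrow> x < t \<Longrightarrow> F < 0" and "x < s \<or> t < x \<Longrightarrow> F > 0"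
proof -
  have pos: "sin (u / 2) > 0" if "0 < u" "u < 2 * pi" for u
    using that by (intro sin_gt_zero) auto
  have neg: "sin (u / 2) < 0" if "u < 0" "- (2 * pi) < u" for u
    using pos[of "- u"] that by simp
  have F: "F = 4 * \<rho>\<^sup>2 * sin ((t - s) / 2) * (sin ((x - s) / 2) * sin ((x - t) / 2))"
    unfolding F_def cross2_circle_points by simp
  have c: "4 * \<rho>\<^sup>2 * sin ((t - s) / 2) > 0"
    using assms pos[of "t - s"] by simp
  show "F < 0" if "s < x" "x < t"
  proof -
    have "sin ((x - s) / 2) * sin ((x - t) / 2) < 0"
      using that assms by (intro mult_pos_neg pos neg) auto
    then show ?thesis unfolding F using c by (simp add: mult_pos_neg)
  qed
  show "F > 0" if "x < s \<or> t < x"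
  proof -
    have "sin ((x - s) / 2) * sin ((x - t) / 2) > 0"
      using that
    proof
      assume "x < s"
      then show ?thesis using assms by (intro mult_neg_neg neg) auto
    next
      assume "t < x"
      then show ?thesis using assms by (intro mult_pos_pos pos) auto
    qed
    then show ?thesis unfolding F using c by simp
  qed
qed

lemma chords_disjoint_iff_separated:
  assumes "\<rho> > 0" "0 \<le> s" "s < t" "t < 2 * pi" "0 \<le> u" "u < v" "v < 2 * pi"
  shows "closed_segment (circle_point c \<rho> s) (circle_point c \<rho> t) \<inter>
         closed_segment (circle_point c \<rho> u) (circle_point c \<rho> v) = {} \<longleftrightarrow> separated s t u v"
proof -
  let ?P = "circle_point c \<rho>"
  define F where "F s t x = cross2 (?P t - ?P s) (?P x - ?P s)" for s t x
  have neg: "F s t x < 0" if "0 \<le> s" "t < 2 * pi" "s < x" "x < t" for s t x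
    using cross2_circle_points_sign(1)[of \<rho> s t x c] that assms(1) by (simp add: F_def)
  have pos: "F s t x > 0" if "0 \<le> s" "s < t" "t < 2 * pi" "0 \<le> x" "x < 2 * pi" "x < s \<or> t < x" for s t x
    using cross2_circle_points_sign(2)[of \<rho> s t x c] that assms(1) by (simp add: F_def)
  \<comment> \<open>In order: a common endpoint, the two ways to interleave, \<open>u\<close> and
    \<open>v\<close> both inside the interval from \<open>s\<close> to \<open>t\<close>, both
    outside it.\<close>
  consider "s = u \<or> s = v \<or> t = u \<or> t = v" | "s < u" "u < t" "t < v" | "u < s" "s < v" "v < t"
    | "s < u" "v < t" | "v < s \<or> t < u \<or> u < s \<and> t < v"
    by linarith
  then show ?thesis
  proof cases
    case 1
    then have "closed_segment (?P s) (?P t) \<inter> closed_segment (?P u) (?P v) \<noteq> {}"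
      by blast
    moreover have "\<not> separated s t u v"
      using 1 assms by (auto simp: separated_def)
    ultimately show ?thesis by simp
  next
    case 2
    have "F s t u * F s t v < 0" using 2 assms by (intro mult_neg_pos neg pos) auto
    moreover have "F u v s * F u v t < 0" using 2 assms by (intro mult_pos_neg neg pos) auto
    ultimately have "closed_segment (?P s) (?P t) \<inter> closed_segment (?P u) (?P v) \<noteq> {}"
      unfolding F_def by (rule closed_segments_meet)
    moreover have "\<not> separated s t u v"
      using 2 assms by (auto simp: separated_def)
    ultimately show ?thesis by simp
  next
    case 3
    have "F s t u * F s t v < 0" using 3 assms by (intro mult_pos_neg neg pos) auto
    moreover have "F u v s * F u v t < 0" using 3 assms by (intro mult_neg_pos neg pos) auto
    ultimately have "closed_segment (?P s) (?P t) \<inter> closed_segment (?P u) (?P v) \<noteq> {}"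
      unfolding F_def by (rule closed_segments_meet)
    moreover have "\<not> separated s t u v"
      using 3 assms by (auto simp: separated_def)
    ultimately show ?thesis by simp
  next
    case 4
    have "F s t u * F s t v > 0" using 4 assms by (intro mult_neg_neg neg) auto
    then have "closed_segment (?P s) (?P t) \<inter> closed_segment (?P u) (?P v) = {}"
      unfolding F_def by (rule closed_segments_disjoint)
    moreover have "separated s t u v"
      using 4 by (auto simp: separated_def)
    ultimately show ?thesis by simp
  next
    case 5
    have "F s t u * F s t v > 0" using 5 assms by (intro mult_pos_pos pos) auto
    then have "closed_segment (?P s) (?P t) \<inter> closed_segment (?P u) (?P v) = {}"
      unfolding F_def by (rule closed_segments_disjoint)
    moreover have "separated s t u v"
      using 5 by (auto simp: separated_def)
    ultimately show ?thesis by simp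
  qed
qed

lemma circle_graph_interval_model:
  assumes "circle_graph G"
  obtains l r where "\<And>v. v \<in> pverts G \<Longrightarrow> 0 \<le> l v \<and> l v < r v \<and> r v < 2 * pi"
    and "\<And>u v. u \<in> pverts G \<Longrightarrow> v \<in> pverts G \<Longrightarrow> u \<noteq> v \<Longrightarrow>
          (u, v) \<in> parcs G \<longleftrightarrow> \<not> separated (l u) (r u) (l v) (r v)"
proof -
  obtain c \<rho> S where "\<rho> > 0" and ch: "\<And>v. v \<in> pverts G \<Longrightarrow> is_chord c \<rho> (S v)"
    and int: "is_intersection_graph G S"
    using assms unfolding circle_graph_def by blast
  let ?P = "circle_point c \<rho>"
  have "\<exists>s t. 0 \<le> s \<and> s < t \<and> t < 2 * pi \<and> S v = closed_segment (?P s) (?P t)" if v: "v \<in> pverts G" for v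
  proof -
    obtain a b where ab: "a \<in> sphere c \<rho>" "b \<in> sphere c \<rho>" "a \<noteq> b" "S v = closed_segment a b"
      using ch[OF v] unfolding is_chord_def by blast
    obtain s where s: "0 \<le> s" "s < 2 * pi" "a = ?P s"
      using circle_point_exists[OF ab(1) \<open>\<rho> > 0\<close>] .
    obtain t where t: "0 \<le> t" "t < 2 * pi" "b = ?P t"
      using circle_point_exists[OF ab(2) \<open>\<rho> > 0\<close>] .
    have "s \<noteq> t" using ab(3) s(3) t(3) by blast
    then have "s < t \<or> t < s" by linarith
    then show ?thesis
      using s t ab(4) closed_segment_commute by metis
  qed
  then obtain l r where lr: "\<And>v. v \<in> pverts G \<Longrightarrow> 0 \<le> l v \<and> l v < r v \<and> r v < 2 * pi \<and>
      S v = closed_segment (?P (l v)) (?P (r v))"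
    by metis
  show ?thesis
  proof (rule that[of l r])
    show "0 \<le> l v \<and> l v < r v \<and> r v < 2 * pi" if "v \<in> pverts G" for v
      using lr that by blast
    show "(u, v) \<in> parcs G \<longleftrightarrow> \<not> separated (l u) (r u) (l v) (r v)"
      if "u \<in> pverts G" "v \<in> pverts G" "u \<noteq> v" for u v
      using int that lr[of u] lr[of v]
        chords_disjoint_iff_separated[OF \<open>\<rho> > 0\<close>, of "l u" "r u" "l v" "r v" c]
      unfolding is_intersection_graph_def by auto
  qed
qed


section \<open>Stick representations from an order on the vertices\<close>

text \<open>\<open>p\<close> is the rank in the lexicographic order by \<open>f\<close>, then
  \<open>g\<close>, then an arbitrary numbering \<open>e\<close>, which makes the ranks
  distinct.\<close>

lemma finite_lexicographic_position:
  fixes f g :: "'a \<Rightarrow> real"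
  assumes "finite V"
  obtains p :: "'a \<Rightarrow> real" where "inj_on p V"
    and "\<And>u v. u \<in> V \<Longrightarrow> v \<in> V \<Longrightarrow> p u < p v \<Longrightarrow> f u < f v \<or> f u = f v \<and> g u \<le> g v"
proof -
  obtain e :: "'a \<Rightarrow> nat" where e: "inj_on e V"
    using finite_imp_inj_to_nat_seg[OF assms] by blast
  define lt where "lt u v \<longleftrightarrow> f u < f v \<or> f u = f v \<and> (g u < g v \<or> g u = g v \<and> e u < e v)" for u v
  define p where "p v = real (card {w \<in> V. lt w v})" for v
  have mono: "p u < p v" if "lt u v" "u \<in> V" for u v
  proof -
    have "{w \<in> V. lt w u} \<subset> {w \<in> V. lt w v}"
      using that unfolding lt_def by (intro psubsetI) auto
    then show ?thesis
      using assms unfolding p_def by (simp add: psubset_card_mono)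
  qed
  have total: "lt u v \<or> lt v u \<or> u = v" if "u \<in> V" "v \<in> V" for u v
    using that inj_onD[OF e] unfolding lt_def by (metis linorder_neqE_nat linorder_less_linear)
  show ?thesis
  proof (rule that)
    show "inj_on p V"
      by (rule inj_onI) (metis total mono less_irrefl)
    show "f u < f v \<or> f u = f v \<and> g u \<le> g v" if "u \<in> V" "v \<in> V" "p u < p v" for u v
    proof -
      have "lt u v" using total mono that by (metis less_asym less_irrefl)
      then show ?thesis unfolding lt_def by auto
    qed
  qed
qed

text \<open>This chooses the length \<open>t\<close> of a stick: \<open>D\<close> holds the
  distances to the sticks it could cross, \<open>N\<close> those to its neighbours.\<close>

lemma finite_threshold:
  fixes D N :: "real set"
  assumes "finite D" "N \<subseteq> D" "\<And>d. d \<in> D \<Longrightarrow> d > 0"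
  shows "\<exists>t>0. \<forall>d\<in>D. d \<le> t \<longleftrightarrow> (\<exists>n\<in>N. d \<le> n)"
proof (cases "N = {}")
  case True
  \<comment> \<open>Without neighbours the stick still needs positive length but must reach nothing
    in \<open>D\<close>; the 1 covers empty \<open>D\<close>.\<close>
  have "Min (insert 1 D) > 0" using assms by simp
  moreover have "Min (insert 1 D) \<le> d" if "d \<in> D" for d using that assms(1) by simp
  ultimately show ?thesis
    using True by (intro exI[of _ "Min (insert 1 D) / 2"]) fastforce
next
  case False
  have fin: "finite N" using assms finite_subset by blast
  have "Max N \<in> N" using fin False by (rule Max_in)
  moreover have "n \<le> Max N" if "n \<in> N" for n using that fin by simp
  ultimately show ?thesis
    using assms by (intro exI[of _ "Max N"]) (meson order_trans subsetD)
qed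

text \<open>Each vertex \<open>v\<close> is put at \<open>(p v, - p v)\<close>, with a vertical
  stick if it is in \<open>A\<close> and a horizontal one if it is in \<open>B\<close>, reaching as
  far as its last neighbour. The sticks of \<open>a\<close> and \<open>b\<close> can meet only in
  \<open>(p a, - p b)\<close>.\<close>

lemma stick_graph_of_order:
  fixes G :: "'a pair_pre_digraph" and p :: "'a \<Rightarrow> real"
  assumes G: "pair_graph G"
    and V: "A \<union> B = pverts G" "A \<inter> B = {}" "parcs G \<subseteq> A \<times> B \<union> B \<times> A"
    and inj: "inj_on p (pverts G)"
    and edge: "\<And>a b. a \<in> A \<Longrightarrow> b \<in> B \<Longrightarrow> (a, b) \<in> parcs G \<Longrightarrow> p b < p a"
    and fill: "\<And>a a' b b'. a \<in> A \<Longrightarrow> a' \<in> A \<Longrightarrow> b \<in> B \<Longrightarrow> b' \<in> B \<Longrightarrow>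
      (a, b') \<in> parcs G \<Longrightarrow> (a', b) \<in> parcs G \<Longrightarrow>
      p b' < p b \<Longrightarrow> p b < p a \<Longrightarrow> p a < p a' \<Longrightarrow> (a, b) \<in> parcs G"
  shows "stick_graph G"
proof -
  interpret pair_graph G by fact
  have fin: "finite A" "finite B" using pair_finite_verts V(1) by (metis finite_Un)+
  have sym: "(u, v) \<in> parcs G \<longleftrightarrow> (v, u) \<in> parcs G" for u v
    using pair_sym_arcs by (auto simp: symmetric_def sym_def)
  have "\<exists>t>0. \<forall>b\<in>B. p b < p a \<longrightarrow> (p a - p b \<le> t \<longleftrightarrow> (\<exists>b'\<in>B. (a, b') \<in> parcs G \<and> p b' \<le> p b))"
    if "a \<in> A" for a
  proof -
    have "\<exists>t>0. \<forall>d\<in>(\<lambda>b. p a - p b) ` {b \<in> B. p b < p a}.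
        d \<le> t \<longleftrightarrow> (\<exists>n\<in>(\<lambda>b. p a - p b) ` {b \<in> B. (a, b) \<in> parcs G}. d \<le> n)"
      using fin edge[OF that] by (intro finite_threshold) auto
    then show ?thesis by (elim ex_forward) auto
  qed
  then obtain X where X: "\<And>a. a \<in> A \<Longrightarrow> X a > 0"
    "\<And>a b. a \<in> A \<Longrightarrow> b \<in> B \<Longrightarrow> p b < p a \<Longrightarrow>
      p a - p b \<le> X a \<longleftrightarrow> (\<exists>b'\<in>B. (a, b') \<in> parcs G \<and> p b' \<le> p b)"
    by metis
  have "\<exists>t>0. \<forall>a\<in>A. p b < p a \<longrightarrow> (p a - p b \<le> t \<longleftrightarrow> (\<exists>a'\<in>A. (a', b) \<in> parcs G \<and> p a \<le> p a'))"
    if "b \<in> B" for b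
  proof -
    have "\<exists>t>0. \<forall>d\<in>(\<lambda>a. p a - p b) ` {a \<in> A. p b < p a}.
        d \<le> t \<longleftrightarrow> (\<exists>n\<in>(\<lambda>a. p a - p b) ` {a \<in> A. (a, b) \<in> parcs G}. d \<le> n)"
      using fin edge[OF _ that] by (intro finite_threshold) auto
    then show ?thesis by (elim ex_forward) auto
  qed
  then obtain Y where Y: "\<And>b. b \<in> B \<Longrightarrow> Y b > 0"
    "\<And>a b. a \<in> A \<Longrightarrow> b \<in> B \<Longrightarrow> p b < p a \<Longrightarrow>
      p a - p b \<le> Y b \<longleftrightarrow> (\<exists>a'\<in>A. (a', b) \<in> parcs G \<and> p a \<le> p a')"
    by metis
  have p_eq: "p u = p v \<longleftrightarrow> u = v" if "u \<in> A \<union> B" "v \<in> A \<union> B" for u v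
    using that inj V(1) by (auto dest: inj_onD)
  have adj: "(a, b) \<in> parcs G \<longleftrightarrow> p b \<le> p a \<and> p a - p b \<le> X a \<and> p a - p b \<le> Y b"
    if ab: "a \<in> A" "b \<in> B" for a b
  proof
    assume "(a, b) \<in> parcs G"
    then show "p b \<le> p a \<and> p a - p b \<le> X a \<and> p a - p b \<le> Y b"
      using edge[OF ab] X(2)[OF ab] Y(2)[OF ab] ab by auto
  next
    assume R: "p b \<le> p a \<and> p a - p b \<le> X a \<and> p a - p b \<le> Y b"
    have "p b < p a" using R p_eq[of a b] ab V(2) by force
    \<comment> \<open>The stick of \<open>a\<close> reaches to a neighbour \<open>b'\<close> at or
      before \<open>b\<close>, that of \<open>b\<close> to a neighbour \<open>a'\<close> at or
      beyond \<open>a\<close>. Either one of these pairs is the edge itself, or both inequalities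
      are strict and \<open>fill\<close> applies.\<close>
    then obtain a' b' where *: "a' \<in> A" "b' \<in> B" "(a, b') \<in> parcs G" "(a', b) \<in> parcs G"
      "p b' \<le> p b" "p a \<le> p a'"
      using X(2)[OF ab] Y(2)[OF ab] R by blast
    show "(a, b) \<in> parcs G"
    proof (cases "a = a' \<or> b = b'")
      case True
      then show ?thesis using * by blast
    next
      case False
      then have "p b' < p b" "p a < p a'"
        using * ab p_eq[of a a'] p_eq[of b b'] by force+
      then show ?thesis using fill * ab \<open>p b < p a\<close> by blast
    qed
  qed
  define S where "S v = (if v \<in> A then closed_segment (p v, - p v) (p v, - p v + X v)
    else closed_segment (p v, - p v) (p v + Y v, - p v))" for v
  have SA: "S a = {p a} \<times> {- p a .. - p a + X a}" if "a \<in> A" for a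
    using that X(1)[OF that] by (simp add: S_def closed_segment_same_fst closed_segment_eq_real_ivl)
  have SB: "S b = {p b .. p b + Y b} \<times> {- p b}" if "b \<in> B" for b
  proof -
    have "b \<notin> A" using that V(2) by blast
    then show ?thesis
      using Y(1)[OF that] by (simp add: S_def closed_segment_same_snd closed_segment_eq_real_ivl)
  qed
  have AA: "S u \<inter> S v = {}" if "u \<in> A" "v \<in> A" "u \<noteq> v" for u v
    using that p_eq[of u v] by (auto simp: SA)
  have BB: "S u \<inter> S v = {}" if "u \<in> B" "v \<in> B" "u \<noteq> v" for u v
    using that p_eq[of u v] by (auto simp: SB)
  have AB: "S a \<inter> S b \<noteq> {} \<longleftrightarrow> (a, b) \<in> parcs G" if "a \<in> A" "b \<in> B" for a b
  proof -
    have "S a \<inter> S b \<noteq> {} \<longleftrightarrow> (p a, - p b) \<in> S a \<inter> S b"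
      unfolding SA[OF that(1)] SB[OF that(2)] by blast
    then show ?thesis
      unfolding adj[OF that] SA[OF that(1)] SB[OF that(2)] by auto
  qed
  have noAA: "(u, v) \<notin> parcs G" if "u \<in> A" "v \<in> A" for u v using that V by blast
  have noBB: "(u, v) \<notin> parcs G" if "u \<in> B" "v \<in> B" for u v using that V by blast
  have ABne: "S a \<noteq> S b" if "a \<in> A" "b \<in> B" for a b
  proof
    assume "S a = S b"
    then have "(p a, - p a) \<in> S b" "(p a, - p a + X a) \<in> S b"
      using SA[OF that(1)] X(1)[OF that(1)] by auto
    then show False using SB[OF that(2)] X(1)[OF that(1)] by auto
  qed
  have ne: "S v \<noteq> {}" for v by (simp add: S_def)
  have "inj_on S (pverts G)"
  proof (rule inj_onI)
    fix u v assume uv: "u \<in> pverts G" "v \<in> pverts G" "S u = S v"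
    then consider "u \<in> A" "v \<in> A" | "u \<in> B" "v \<in> B" | "u \<in> A" "v \<in> B" | "u \<in> B" "v \<in> A"
      using V(1) by blast
    then show "u = v"
      using AA[of u v] BB[of u v] ABne[of u v] ABne[of v u] uv(3) ne[of v] by cases auto
  qed
  moreover have "vertical_stick 0 (S v) \<or> horizontal_stick 0 (S v)" if "v \<in> pverts G" for v
  proof (cases "v \<in> A")
    case True
    then have "vertical_stick 0 (S v)"
      using X(1) unfolding vertical_stick_def S_def
      by (intro exI[of _ "p v"] exI[of _ "- p v"] exI[of _ "X v"]) simp
    then show ?thesis ..
  next
    case False
    then have "horizontal_stick 0 (S v)"
      using Y(1) that V(1) unfolding horizontal_stick_def S_def
      by (intro exI[of _ "p v"] exI[of _ "- p v"] exI[of _ "Y v"]) auto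
    then show ?thesis ..
  qed
  moreover have "is_intersection_graph G S"
    unfolding is_intersection_graph_def
  proof (intro ballI impI)
    fix u v assume uv: "u \<in> pverts G" "v \<in> pverts G" "u \<noteq> v"
    then consider "u \<in> A" "v \<in> A" | "u \<in> B" "v \<in> B" | "u \<in> A" "v \<in> B" | "u \<in> B" "v \<in> A"
      using V(1) by blast
    then show "(u, v) \<in> parcs G \<longleftrightarrow> S u \<inter> S v \<noteq> {}"
      using AA[of u v] BB[of u v] AB[of u v] AB[of v u] noAA[of u v] noBB[of u v] uv(3) sym[of u v]
      by cases (auto simp: Int_commute)
  qed
  ultimately show ?thesis unfolding stick_graph_def by blast
qed

section \<open>From intervals to an order, and the choice of the cut\<close>

text \<open>By \<open>noleft\<close> an edge has one of three shapes: \<open>b\<close> before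
  \<open>a\<close>, \<open>b\<close> inside \<open>a\<close>, or \<open>a\<close> inside
  \<open>b\<close>. Since chords on the same side meet, each vertex fixes by itself which of its two
  arcs avoids all its neighbours.\<close>

lemma stick_graph_of_intervals_no_left:
  fixes G :: "'a pair_pre_digraph" and l r :: "'a \<Rightarrow> real"
  assumes G: "pair_graph G"
    and V: "A \<union> B = pverts G" "A \<inter> B = {}" "parcs G \<subseteq> A \<times> B \<union> B \<times> A"
    and bd: "\<And>v. v \<in> pverts G \<Longrightarrow> 0 \<le> l v \<and> l v < r v \<and> r v < K"
    and cA: "\<And>u v. u \<in> A \<Longrightarrow> v \<in> A \<Longrightarrow> \<not> separated (l u) (r u) (l v) (r v)"
    and cB: "\<And>u v. u \<in> B \<Longrightarrow> v \<in> B \<Longrightarrow> \<not> separated (l u) (r u) (l v) (r v)"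
    and adj: "\<And>a b. a \<in> A \<Longrightarrow> b \<in> B \<Longrightarrow> (a, b) \<in> parcs G \<longleftrightarrow> separated (l a) (r a) (l b) (r b)"
    and noleft: "\<And>a b. a \<in> A \<Longrightarrow> b \<in> B \<Longrightarrow> l b \<le> r a"
  shows "stick_graph G"
proof -
  interpret pair_graph G by fact
  define WA where "WA a \<longleftrightarrow> (\<exists>b\<in>B. l a < l b \<and> r b < r a)" for a
  define WB where "WB b \<longleftrightarrow> (\<exists>a\<in>A. l b < l a \<and> r a < r b)" for b
  \<comment> \<open>The position \<open>f\<close> is the start (on \<open>A\<close>) or the end (on \<open>B\<close>) of the arc; \<open>WA\<close> and \<open>WB\<close> hold for arcs
    through the cut point. Ties between two vertices of \<open>A\<close> are broken by the other end of the
    arc. On a tie between \<open>A\<close> and \<open>B\<close> the chords touch, so they are not adjacent and \<open>b\<close> must come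
    after \<open>a\<close>: hence the large value \<open>2 * K\<close>.\<close>
  define f where "f v = (if v \<in> A then if WA v then r v else l v else if WB v then l v else r v)" for v
  define g where "g v = (if v \<in> A then if WA v then l v + K else r v else 2 * K)" for v
  obtain p :: "'a \<Rightarrow> real" where inj: "inj_on p (pverts G)"
    and p: "\<And>u v. u \<in> pverts G \<Longrightarrow> v \<in> pverts G \<Longrightarrow> p u < p v \<Longrightarrow> f u < f v \<or> f u = f v \<and> g u \<le> g v"
    using finite_lexicographic_position[OF pair_finite_verts] by blast
  have fA: "f a = (if WA a then r a else l a)" "g a = (if WA a then l a + K else r a)" if "a \<in> A" for a
    using that by (simp_all add: f_def g_def)
  have fB: "f b = (if WB b then l b else r b)" "g b = 2 * K" if "b \<in> B" for b
  proof -
    have "b \<notin> A" using that V(2) by blast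
    then show "f b = (if WB b then l b else r b)" "g b = 2 * K"
      by (simp_all add: f_def g_def)
  qed
  have bdA: "0 \<le> l a \<and> l a < r a \<and> r a < K" if "a \<in> A" for a using bd that V(1) by blast
  have bdB: "0 \<le> l b \<and> l b < r b \<and> r b < K" if "b \<in> B" for b using bd that V(1) by blast
  have cases: "r b < l a \<and> \<not> WA a \<and> \<not> WB b \<or> l a < l b \<and> r b < r a \<and> WA a \<and> \<not> WB b \<or>
      l b < l a \<and> r a < r b \<and> \<not> WA a \<and> WB b"
    if ab: "a \<in> A" "b \<in> B" "(a, b) \<in> parcs G" for a b
  proof -
    \<comment> \<open>Otherwise an interval of \<open>B\<close> inside that of \<open>a\<close>
      would be separated from that of \<open>b\<close>; \<open>WB1\<close> is the same with the
      sides exchanged.\<close>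
    have WA1: "\<not> WA a" if "r b < l a \<or> l b < l a \<and> r a < r b"
      using that cB[OF ab(2)] bdB ab(2) unfolding WA_def separated_def by force
    have WB1: "\<not> WB b" if "r b < l a \<or> l a < l b \<and> r b < r a"
      using that cA[OF ab(1)] bdA ab(1) unfolding WB_def separated_def by force
    have "r b < l a \<or> l a < l b \<and> r b < r a \<or> l b < l a \<and> r a < r b"
      using ab adj noleft[of a b] by (auto simp: separated_def)
    then show ?thesis using WA1 WB1 ab unfolding WA_def WB_def by blast
  qed
  have vals: "r b < l a \<and> f b = r b \<and> f a = l a \<and> g a = r a \<or>
      l a < l b \<and> r b < r a \<and> f b = r b \<and> f a = r a \<and> g a = l a + K \<or>
      l b < l a \<and> r a < r b \<and> f b = l b \<and> f a = l a \<and> g a = r a"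
    if "a \<in> A" "b \<in> B" "(a, b) \<in> parcs G" for a b
    using cases[OF that] fA[OF that(1)] fB[OF that(2)] by auto
  have lt: "f b < f a" if "a \<in> A" "b \<in> B" "(a, b) \<in> parcs G" for a b
    using cases[OF that] bdA[OF that(1)] bdB[OF that(2)] fA[OF that(1)] fB[OF that(2)] by auto
  show ?thesis
  proof (rule stick_graph_of_order[OF G V inj])
    show "p b < p a" if ab: "a \<in> A" "b \<in> B" "(a, b) \<in> parcs G" for a b
    proof (rule ccontr)
      assume "\<not> p b < p a"
      moreover have "p a \<noteq> p b" using inj ab V by (auto dest: inj_onD)
      ultimately have "f a \<le> f b" using p[of a b] ab V(1) by force
      then show False using lt[OF ab] by simp
    qed
    show "(a, b) \<in> parcs G" if A: "a \<in> A" "a' \<in> A" and B: "b \<in> B" "b' \<in> B"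
      and e: "(a, b') \<in> parcs G" "(a', b) \<in> parcs G"
      and o: "p b' < p b" "p b < p a" "p a < p a'" for a a' b b'
    proof (rule ccontr)
      assume "(a, b) \<notin> parcs G"
      have V': "a \<in> pverts G" "a' \<in> pverts G" "b \<in> pverts G" "b' \<in> pverts G"
        using A B V(1) by blast+
      from \<open>(a, b) \<notin> parcs G\<close> have ab: "\<not> separated (l a) (r a) (l b) (r b)" using adj A B by blast
      have "f b' \<le> f b"
        using p[OF V'(4,3) o(1)] by auto
      moreover have "f b < f a"
        using p[OF V'(3,1) o(2)] fA(2)[OF A(1)] fB(2)[OF B(1)] bdA[OF A(1)] by (auto split: if_splits)
      moreover have "f a < f a' \<or> f a = f a' \<and> g a \<le> g a'"
        using p[OF V'(1,2) o(3)] .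
      \<comment> \<open>The arc of \<open>a\<close> runs from \<open>f a\<close> to
        \<open>g a\<close>. It starts after the arc of \<open>b\<close> ends but meets it, so it
        runs on at least to the next start of that arc, one turn \<open>K\<close> later. The arc of
        \<open>a'\<close> stops before this, so \<open>g a' < g a\<close>. A tie
        \<open>f a = f a'\<close> contradicts the tie-break; \<open>f a < f a'\<close> makes
        \<open>a\<close> and \<open>a'\<close> separated.\<close>
      ultimately show False
        using vals[OF A(1) B(2) e(1)] vals[OF A(2) B(1) e(2)]
        bdA[OF A(1)] bdA[OF A(2)] bdB[OF B(1)] bdB[OF B(2)] ab cA[OF A] cB[OF B]
        unfolding separated_def by (smt (verit))
    qed
  qed
qed

text \<open>The cut point is arbitrary, since moving it preserves \<open>separated\<close>; it is
  moved so that \<open>noleft\<close> holds.\<close>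

lemma stick_graph_of_intervals:
  fixes G :: "'a pair_pre_digraph" and l r :: "'a \<Rightarrow> real"
  assumes G: "pair_graph G"
    and V: "A \<union> B = pverts G" "A \<inter> B = {}" "parcs G \<subseteq> A \<times> B \<union> B \<times> A"
    and bd: "\<And>v. v \<in> pverts G \<Longrightarrow> 0 \<le> l v \<and> l v < r v \<and> r v < K"
    and cA: "\<And>u v. u \<in> A \<Longrightarrow> v \<in> A \<Longrightarrow> \<not> separated (l u) (r u) (l v) (r v)"
    and cB: "\<And>u v. u \<in> B \<Longrightarrow> v \<in> B \<Longrightarrow> \<not> separated (l u) (r u) (l v) (r v)"
    and adj: "\<And>a b. a \<in> A \<Longrightarrow> b \<in> B \<Longrightarrow> (a, b) \<in> parcs G \<longleftrightarrow> separated (l a) (r a) (l b) (r b)"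
  shows "stick_graph G"
proof (cases "\<exists>a\<in>A. \<exists>b\<in>B. r a < l b")
  case False
  then show ?thesis
    by (intro stick_graph_of_intervals_no_left[OF G V bd cA cB adj]) (auto simp: not_less)
next
  case True
  then obtain a\<^sub>0 b\<^sub>0 where 0: "a\<^sub>0 \<in> A" "b\<^sub>0 \<in> B" "r a\<^sub>0 < l b\<^sub>0" by blast
  interpret pair_graph G by fact
  have bdA: "0 \<le> l a \<and> l a < r a \<and> r a < K" if "a \<in> A" for a using bd that V(1) by blast
  have bdB: "0 \<le> l b \<and> l b < r b \<and> r b < K" if "b \<in> B" for b using bd that V(1) by blast
  \<comment> \<open>The new cut point is the rightmost left end among the chords of \<open>A\<close> whose interval contains no
    interval of \<open>B\<close>.\<close>
  define R where "R = {a \<in> A. \<not> (\<exists>b\<in>B. l a < l b \<and> r b < r a)}"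
  have R: "a \<in> R" if "a \<in> A" "b \<in> B" "r a < l b \<or> l b < l a \<and> r a < r b" for a b
    using that cB[OF that(2)] bdB unfolding R_def separated_def by force
  have "finite R"
    by (rule finite_subset[OF _ pair_finite_verts]) (use V(1) in \<open>auto simp: R_def\<close>)
  define x where "x = Max (l ` R)"
  have max: "l a \<le> x" if "a \<in> R" for a
    using that \<open>finite R\<close> by (simp add: x_def)
  have "x \<in> l ` R"
    using R[OF 0(1,2)] 0(3) \<open>finite R\<close> unfolding x_def by (intro Max_in) auto
  then obtain m where m: "m \<in> A" "l m = x" by (auto simp: R_def)
  have "x \<le> r a\<^sub>0" using cA[OF m(1) 0(1)] m by (auto simp: separated_def)
  \<comment> \<open>\<open>b\<close> meets \<open>b\<^sub>0\<close>, so \<open>r b\<close> is at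
    least \<open>l b\<^sub>0\<close>, which lies beyond \<open>r a\<^sub>0\<close> and hence beyond
    \<open>x\<close>.\<close>
  then have xB: "x < r b" if "b \<in> B" for b
    using cB[OF that 0(2)] 0(3) by (force simp: separated_def)
  \<comment> \<open>Endpoints up to \<open>x\<close> are shifted by a full turn \<open>K\<close>. If
    only the left one is shifted, the two endpoints change roles.\<close>
  define l' where "l' v = (if x < l v then l v else if x < r v then r v else l v + K)" for v
  define r' where "r' v = (if x < l v then r v else if x < r v then l v + K else r v + K)" for v
  have x: "0 \<le> x" "x < K" using bdA[OF m(1)] m(2) by auto
  \<comment> \<open>A new cut may exchange disjointness and nesting, but \<open>separated\<close>
    covers both.\<close>
  have sep: "separated (l' u) (r' u) (l' v) (r' v) \<longleftrightarrow> separated (l u) (r u) (l v) (r v)"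
    if "u \<in> pverts G" "v \<in> pverts G" for u v
    using bd[OF that(1)] bd[OF that(2)] x unfolding separated_def l'_def r'_def
    by (cases "x < l u"; cases "x < r u"; cases "x < l v"; cases "x < r v"; simp; argo)
  show ?thesis
  proof (rule stick_graph_of_intervals_no_left[OF G V, of l' r' "2 * K"])
    show "0 \<le> l' v \<and> l' v < r' v \<and> r' v < 2 * K" if "v \<in> pverts G" for v
      using bd[OF that] unfolding l'_def r'_def by auto
    show "\<not> separated (l' u) (r' u) (l' v) (r' v)" if "u \<in> A" "v \<in> A" for u v
      using sep[of u v] cA that V(1) by blast
    show "\<not> separated (l' u) (r' u) (l' v) (r' v)" if "u \<in> B" "v \<in> B" for u v
      using sep[of u v] cB that V(1) by blast
    show "(a, b) \<in> parcs G \<longleftrightarrow> separated (l' a) (r' a) (l' b) (r' b)" if "a \<in> A" "b \<in> B" for a b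
      using sep[of a b] adj that V(1) by blast
    show "l' b \<le> r' a" if "a \<in> A" "b \<in> B" for a b
    proof -
      \<comment> \<open>If \<open>l a \<le> x\<close>, then \<open>r' a\<close> is at least
        \<open>K\<close>, while \<open>xB\<close> keeps \<open>l' b\<close> below \<open>K\<close>.
        If \<open>x < l a\<close>, then \<open>a\<close> is not in \<open>R\<close>, so by
        \<open>R\<close> the interval of \<open>a\<close> is neither left of nor inside that of
        \<open>b\<close>.\<close>
      have "r a < l b \<or> l b < l a \<and> r a < r b \<longrightarrow> l a \<le> x"
        using R[OF that] max by blast
      then show ?thesis
        using xB[OF that(2)] bdA[OF that(1)] bdB[OF that(2)] x unfolding l'_def r'_def by auto
    qed
  qed
qed

theorem theorem2:
  fixes G :: "'a pair_pre_digraph"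
  assumes "pair_graph G"
    and "bipartite G"
    and "circle_graph (graph_complement G)"
  shows "stick_graph G"
proof -
  obtain A B where V: "A \<union> B = pverts G" "A \<inter> B = {}" "parcs G \<subseteq> A \<times> B \<union> B \<times> A"
    using assms(2) unfolding bipartite_def by blast
  obtain l r where bd: "\<And>v. v \<in> pverts (graph_complement G) \<Longrightarrow> 0 \<le> l v \<and> l v < r v \<and> r v < 2 * pi"
    and ch: "\<And>u v. u \<in> pverts (graph_complement G) \<Longrightarrow> v \<in> pverts (graph_complement G) \<Longrightarrow> u \<noteq> v \<Longrightarrow>
      (u, v) \<in> parcs (graph_complement G) \<longleftrightarrow> \<not> separated (l u) (r u) (l v) (r v)"
    using circle_graph_interval_model[OF assms(3)] by blast
  have bd: "0 \<le> l v \<and> l v < r v \<and> r v < 2 * pi" if "v \<in> pverts G" for v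
    using bd that by (simp add: graph_complement_def)
  \<comment> \<open>Equal vertices are included because the cliques are stated for all pairs; there
    \<open>l v < r v\<close> refutes \<open>separated\<close>.\<close>
  have sep: "separated (l u) (r u) (l v) (r v) \<longleftrightarrow> u \<noteq> v \<and> (u, v) \<in> parcs G"
    if "u \<in> pverts G" "v \<in> pverts G" for u v
    using ch[of u v] bd[OF that(1)] that
    by (cases "u = v") (auto simp: graph_complement_def separated_def)
  show ?thesis
  proof (rule stick_graph_of_intervals[OF assms(1) V bd])
    show "\<not> separated (l u) (r u) (l v) (r v)" if "u \<in> A" "v \<in> A" for u v
      using sep[of u v] that V by blast
    show "\<not> separated (l u) (r u) (l v) (r v)" if "u \<in> B" "v \<in> B" for u v
      using sep[of u v] that V by blast
    show "(a, b) \<in> parcs G \<longleftrightarrow> separated (l a) (r a) (l b) (r b)" if "a \<in> A" "b \<in> B" for a b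
      using sep[of a b] that V by blast
  qed
qed

end
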